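(* For $r,s\ge1$, the complex symmetric pair $(\mathrm{Sp}_{2(r+s)},\mathrm{Sp}_{2r}\times\mathrm{Sp}_{2s})$ is pleasant if and only if $r\neq s$. For $n\ge1$, the complex symmetric pair $(\mathrm{Sp}_{2n},\mathrm{GL}_n)$ is not pleasant.
   Context: All groups are complex. A symmetric pair $(G,H,\theta)$ has $H=G^\theta$ for an involution $\theta$ of $G$. Let $\mathrm{Ad}:G\to\mathrm{Aut}\,G$ be the action by conjugation and $\mathcal{A}_\theta=\{g\in G\mid\theta(g)\in gZ(G)\}$. The pair is pleasant if $\mathrm{Ad}\,\mathcal{A}_\theta\subseteq\mathrm{Ad}\,H$. With $I_{p,q}=\begin{pmatrix} I_p & 0 \\ 0 & -I_q \end{pmatrix}$ and $\mathrm{Sp}_{2n}$ defined by the form with matrix $\begin{pmatrix} 0 & -I_n \\ I_n & 0 \end{pmatrix}$, the involutions are: conjugation by $\begin{pmatrix} I_{r,s} & 0 \\ 0 & I_{r,s} \end{pmatrix}$ for $(\mathrm{Sp}_{2(r+s)},\mathrm{Sp}_{2r}\times\mathrm{Sp}_{2s})$; and conjugation by $I_{n,n}$ for $(\mathrm{Sp}_{2n},\mathrm{GL}_n)$. *)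

theory Defs
  imports "Jordan_Normal_Form.Determinant" "HOL-Algebra.Coset" "HOL-Algebra.Bij"
begin

definition grp_center :: "('a, 'b) monoid_scheme \<Rightarrow> 'a set" where
  "grp_center G = {z \<in> carrier G. \<forall>g \<in> carrier G. z \<otimes>\<^bsub>G\<^esub> g = g \<otimes>\<^bsub>G\<^esub> z}"

text \<open>Restricted to the carrier, so that equality of these functions is equality of
  automorphisms of \<open>G\<close>, as for \<^const>\<open>auto\<close>.\<close>

definition Ad :: "('a, 'b) monoid_scheme \<Rightarrow> 'a \<Rightarrow> 'a \<Rightarrow> 'a" where
  "Ad G g = (\<lambda>x \<in> carrier G. g \<otimes>\<^bsub>G\<^esub> x \<otimes>\<^bsub>G\<^esub> inv\<^bsub>G\<^esub> g)"

definition symmetric_pair :: "('a, 'b) monoid_scheme \<Rightarrow> 'a set \<Rightarrow> ('a \<Rightarrow> 'a) \<Rightarrow> bool" where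
  "symmetric_pair G H \<theta> \<longleftrightarrow>
     group G \<and> \<theta> \<in> iso G G \<and> (\<forall>g \<in> carrier G. \<theta> (\<theta> g) = g) \<and>
     H = {g \<in> carrier G. \<theta> g = g}"

definition A_theta :: "('a, 'b) monoid_scheme \<Rightarrow> ('a \<Rightarrow> 'a) \<Rightarrow> 'a set" where
  "A_theta G \<theta> = {g \<in> carrier G. \<theta> g \<in> g <#\<^bsub>G\<^esub> grp_center G}"

definition pleasant :: "('a, 'b) monoid_scheme \<Rightarrow> 'a set \<Rightarrow> ('a \<Rightarrow> 'a) \<Rightarrow> bool" where
  "pleasant G H \<theta> \<longleftrightarrow> Ad G ` A_theta G \<theta> \<subseteq> Ad G ` H"

definition GL :: "nat \<Rightarrow> complex mat monoid" where
  "GL n = units_of (ring_mat TYPE(complex) n ())"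

definition Jform :: "nat \<Rightarrow> complex mat" where
  "Jform n = four_block_mat (0\<^sub>m n n) (- 1\<^sub>m n) (1\<^sub>m n) (0\<^sub>m n n)"

text \<open>\<open>Sp n\<close> is the group of \<open>2n \<times> 2n\<close> matrices usually written \<open>Sp\<close> with index \<open>2n\<close>.\<close>

definition Sp :: "nat \<Rightarrow> complex mat monoid" where
  "Sp n = (GL (2 * n))
     \<lparr>carrier := {g \<in> carrier (GL (2 * n)). transpose_mat g * Jform n * g = Jform n}\<rparr>"

definition diag2 :: "complex mat \<Rightarrow> complex mat \<Rightarrow> complex mat" where
  "diag2 A B = four_block_mat A (0\<^sub>m (dim_row A) (dim_col B)) (0\<^sub>m (dim_row B) (dim_col A)) B"

definition Ipq :: "nat \<Rightarrow> nat \<Rightarrow> complex mat" where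
  "Ipq p q = diag2 (1\<^sub>m p) (- 1\<^sub>m q)"

text \<open>The conjugating matrix need not be symplectic (\<open>Ipq n n\<close> is not), so the conjugation is
  taken in the ambient general linear group; see \<open>symmetric_pair_SpSp\<close> and \<open>symmetric_pair_GLn\<close>
  for the fact that it restricts to an involution of the symplectic group.\<close>

definition theta_SpSp :: "nat \<Rightarrow> nat \<Rightarrow> complex mat \<Rightarrow> complex mat" where
  "theta_SpSp r s = Ad (GL (2 * (r + s))) (diag2 (Ipq r s) (Ipq r s))"

definition theta_GLn :: "nat \<Rightarrow> complex mat \<Rightarrow> complex mat" where
  "theta_GLn n = Ad (GL (2 * n)) (Ipq n n)"

text \<open>With coordinates ordered as \<open>e\<^sub>1, \<dots>, e\<^sub>n, f\<^sub>1, \<dots>, f\<^sub>n\<close> for \<open>n = r + s\<close>, the two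
  factors act on the first \<open>r\<close> and on the last \<open>s\<close> of the pairs \<open>e\<^sub>i, f\<^sub>i\<close>.\<close>

definition SpSp :: "nat \<Rightarrow> nat \<Rightarrow> complex mat set" where
  "SpSp r s = {four_block_mat (diag2 A A') (diag2 B B') (diag2 C C') (diag2 D D')
     | A B C D A' B' C' D'.
       {A, B, C, D} \<subseteq> carrier_mat r r \<and> {A', B', C', D'} \<subseteq> carrier_mat s s \<and>
       four_block_mat A B C D \<in> carrier (Sp r) \<and> four_block_mat A' B' C' D' \<in> carrier (Sp s)}"

definition GLn_in_Sp :: "nat \<Rightarrow> complex mat set" where
  "GLn_in_Sp n = {diag2 A (transpose_mat (inv\<^bsub>GL n\<^esub> A)) | A. A \<in> carrier (GL n)}"

lemma group_GL: "group (GL n)"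
  unfolding GL_def
  by (rule monoid.units_group) (rule ring.is_monoid[OF ring_mat])

lemma GL_simps [simp]:
  "x \<otimes>\<^bsub>GL n\<^esub> y = x * y" "\<one>\<^bsub>GL n\<^esub> = 1\<^sub>m n"
  by (simp_all add: GL_def units_of_def ring_mat_simps)

lemma carrier_GL:
  "A \<in> carrier (GL n) \<longleftrightarrow>
     A \<in> carrier_mat n n \<and> (\<exists>B \<in> carrier_mat n n. A * B = 1\<^sub>m n \<and> B * A = 1\<^sub>m n)"
  by (auto simp: GL_def units_of_def Units_def ring_mat_simps)

lemma GL_D: "A \<in> carrier (GL n) \<Longrightarrow> A \<in> carrier_mat n n"
  by (simp add: carrier_GL)

lemma GL_I:
  assumes "A \<in> carrier_mat n n" "B \<in> carrier_mat n n" "B * A = 1\<^sub>m n"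
  shows "A \<in> carrier (GL n)"
  using assms mat_mult_left_right_inverse[of B n A] by (auto simp: carrier_GL)

lemma GL_inv_eq:
  assumes "A \<in> carrier_mat n n" "B \<in> carrier_mat n n" "B * A = 1\<^sub>m n"
  shows "inv\<^bsub>GL n\<^esub> A = B"
proof (rule group.inv_equality[OF group_GL])
  show "B \<otimes>\<^bsub>GL n\<^esub> A = \<one>\<^bsub>GL n\<^esub>" using assms by simp
  show "A \<in> carrier (GL n)" using GL_I assms by blast
  show "B \<in> carrier (GL n)"
    using GL_I[of B n A] assms mat_mult_left_right_inverse[of B n A] by blast
qed

lemma Jform_carrier: "Jform n \<in> carrier_mat (2 * n) (2 * n)"
  by (simp add: Jform_def mult_2)

lemma uminus_one_mult [simp]: "A \<in> carrier_mat n m \<Longrightarrow> - 1\<^sub>m n * A = - (A :: complex mat)"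
  by (metis left_mult_one_mat one_carrier_mat uminus_mult_left_mat carrier_matD index_one_mat(3))

lemma mult_uminus_one [simp]: "A \<in> carrier_mat n m \<Longrightarrow> A * - 1\<^sub>m m = - (A :: complex mat)"
  by (metis right_mult_one_mat one_carrier_mat uminus_mult_right_mat carrier_matD index_one_mat(2))

lemma uminus_zero_mat' [simp]: "- 0\<^sub>m n m = (0\<^sub>m n m :: complex mat)"
  by (rule eq_matI) auto

lemma uminus_uminus_mat' [simp]: "- (- A) = (A :: complex mat)"
  by (rule eq_matI) auto

lemma four_block_mat_eq_iff:
  assumes "A \<in> carrier_mat a c" "B \<in> carrier_mat a d" "C \<in> carrier_mat b c" "D \<in> carrier_mat b d"
    "A' \<in> carrier_mat a c" "B' \<in> carrier_mat a d" "C' \<in> carrier_mat b c" "D' \<in> carrier_mat b d"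
  shows "four_block_mat A B C D = four_block_mat A' B' C' D' \<longleftrightarrow>
     A = A' \<and> B = B' \<and> C = C' \<and> D = D'"
proof
  assume eq: "four_block_mat A B C D = four_block_mat A' B' C' D'"
  have e: "four_block_mat A B C D $$ (i, j) = four_block_mat A' B' C' D' $$ (i, j)" for i j
    by (simp add: eq)
  show "A = A' \<and> B = B' \<and> C = C' \<and> D = D'"
  proof (intro conjI)
    show "A = A'"
    proof (rule eq_matI)
      fix i j assume "i < dim_row A'" "j < dim_col A'"
      then show "A $$ (i, j) = A' $$ (i, j)" using e[of i j] assms by auto
    qed (use assms in auto)
    show "B = B'"
    proof (rule eq_matI)
      fix i j assume "i < dim_row B'" "j < dim_col B'"
      then show "B $$ (i, j) = B' $$ (i, j)" using e[of i "c + j"] assms by auto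
    qed (use assms in auto)
    show "C = C'"
    proof (rule eq_matI)
      fix i j assume "i < dim_row C'" "j < dim_col C'"
      then show "C $$ (i, j) = C' $$ (i, j)" using e[of "a + i" j] assms by auto
    qed (use assms in auto)
    show "D = D'"
    proof (rule eq_matI)
      fix i j assume "i < dim_row D'" "j < dim_col D'"
      then show "D $$ (i, j) = D' $$ (i, j)" using e[of "a + i" "c + j"] assms by auto
    qed (use assms in auto)
  qed
qed simp

lemma four_blocksE:
  assumes "M \<in> carrier_mat (a + b) (c + d)"
  obtains A B C D where "A \<in> carrier_mat a c" "B \<in> carrier_mat a d" "C \<in> carrier_mat b c"
    "D \<in> carrier_mat b d" "M = four_block_mat A B C D"
proof -
  obtain A B C D where "split_block M a c = (A, B, C, D)"
    by (metis prod_cases4)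
  from split_block[OF this, of b d] assms that show thesis by auto
qed

lemma Jform_sq: "(- Jform n) * Jform n = 1\<^sub>m (2 * n)"
proof -
  have "- Jform n = four_block_mat (0\<^sub>m n n) (1\<^sub>m n) (- 1\<^sub>m n) (0\<^sub>m n n)"
    unfolding Jform_def by (rule eq_matI) auto
  then show ?thesis
    unfolding Jform_def
    by (simp add: mult_four_block_mat[of _ n n _ n _ n _ _ n _ n] mult_2)
qed

lemma Sp_simps [simp]: "x \<otimes>\<^bsub>Sp n\<^esub> y = x * y" "\<one>\<^bsub>Sp n\<^esub> = 1\<^sub>m (2 * n)"
  by (simp_all add: Sp_def)

lemma carrier_Sp:
  "g \<in> carrier (Sp n) \<longleftrightarrow>
     g \<in> carrier_mat (2 * n) (2 * n) \<and> transpose_mat g * Jform n * g = Jform n"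
proof -
  have "g \<in> carrier (GL (2 * n))"
    if g: "g \<in> carrier_mat (2 * n) (2 * n)" and eq: "transpose_mat g * Jform n * g = Jform n"
  proof (rule GL_I[OF g])
    let ?J = "Jform n"
    have J: "?J \<in> carrier_mat (2 * n) (2 * n)" "- ?J \<in> carrier_mat (2 * n) (2 * n)"
      using Jform_carrier by simp_all
    show "- ?J * (transpose_mat g * ?J) \<in> carrier_mat (2 * n) (2 * n)"
      using g J by simp
    have "- ?J * (transpose_mat g * ?J) * g = - ?J * (transpose_mat g * ?J * g)"
      by (rule assoc_mult_mat) (use g J in auto)
    then show "- ?J * (transpose_mat g * ?J) * g = 1\<^sub>m (2 * n)"
      using eq Jform_sq by simp
  qed
  then show ?thesis by (auto simp: Sp_def GL_D)
qed

lemma subgroup_Sp: "subgroup (carrier (Sp n)) (GL (2 * n))"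
proof (rule group.subgroupI[OF group_GL])
  let ?J = "Jform n" and ?m = "2 * n"
  have J: "?J \<in> carrier_mat ?m ?m" by (rule Jform_carrier)
  show "carrier (Sp n) \<subseteq> carrier (GL ?m)" by (auto simp: Sp_def)
  have "1\<^sub>m ?m \<in> carrier (Sp n)" using left_mult_one_mat[OF J] right_mult_one_mat[OF J] by (simp add: carrier_Sp)
  then show "carrier (Sp n) \<noteq> {}" by blast
  fix a assume a: "a \<in> carrier (Sp n)"
  then have aG: "a \<in> carrier (GL ?m)" by (auto simp: Sp_def)
  note ac = GL_D[OF aG]
  have ae: "transpose_mat a * ?J * a = ?J" using a by (simp add: carrier_Sp)
  show "inv\<^bsub>GL ?m\<^esub> a \<in> carrier (Sp n)"
  proof -
    define b where "b = inv\<^bsub>GL ?m\<^esub> a"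
    have bc: "b \<in> carrier_mat ?m ?m"
      unfolding b_def using group.inv_closed[OF group_GL aG] GL_D by blast
    have ab: "a * b = 1\<^sub>m ?m"
      unfolding b_def using group.r_inv[OF group_GL aG] by simp
    have tab: "transpose_mat b * transpose_mat a = 1\<^sub>m ?m"
      using ab transpose_mult[OF ac bc] by simp
    have "transpose_mat b * ?J * b = transpose_mat b * (transpose_mat a * ?J * a) * b"
      by (simp add: ae)
    also have "\<dots> = (transpose_mat b * transpose_mat a) * ?J * (a * b)"
      using ac bc J by (simp add: assoc_mult_mat[of _ ?m ?m _ ?m _ ?m])
    also have "\<dots> = ?J" using J by (simp add: ab tab)
    finally show ?thesis using bc by (simp add: carrier_Sp b_def)
  qed
  fix b assume b: "b \<in> carrier (Sp n)"
  have bc: "b \<in> carrier_mat ?m ?m" and be: "transpose_mat b * ?J * b = ?J"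
    using b by (auto simp: carrier_Sp)
  have "transpose_mat (a * b) * ?J * (a * b) = transpose_mat b * (transpose_mat a * ?J * a) * b"
    using ac bc J by (simp add: transpose_mult[OF ac bc] assoc_mult_mat[of _ ?m ?m _ ?m _ ?m])
  then show "a \<otimes>\<^bsub>GL ?m\<^esub> b \<in> carrier (Sp n)"
    using ac bc by (simp add: carrier_Sp ae be)
qed

lemma Sp_alt: "Sp n = GL (2 * n) \<lparr>carrier := carrier (Sp n)\<rparr>"
  by (simp add: Sp_def)

lemma group_Sp: "group (Sp n)"
  using subgroup.subgroup_is_group[OF subgroup_Sp group_GL] Sp_alt by metis

lemma symmetric_pair_conj:
  fixes n :: nat and c :: complex
  defines "m \<equiv> 2 * n"
  assumes K: "K \<in> carrier_mat m m" and KK: "K * K = 1\<^sub>m m" and KT: "transpose_mat K = K"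
    and KJ: "K * Jform n * K = c \<cdot>\<^sub>m Jform n" and c: "c * c = 1"
  shows "symmetric_pair (Sp n) {g \<in> carrier (Sp n). K * g = g * K} (Ad (GL m) K)"
proof -
  let ?J = "Jform n"
  have J: "?J \<in> carrier_mat m m" unfolding m_def by (rule Jform_carrier)
  have mc: "g \<in> carrier_mat m m" if "g \<in> carrier (Sp n)" for g
    using that by (simp add: carrier_Sp m_def)
  note as = assoc_mult_mat[of _ m m _ m _ m]
  have Ad: "Ad (GL m) K g = K * g * K" if "g \<in> carrier (Sp n)" for g
    using that GL_inv_eq[OF K K KK] by (simp add: Ad_def Sp_def m_def)
  have KKx: "K * (K * x) = x" if "x \<in> carrier_mat m m" for x
    using as[OF K K that] KK that by simp
  have closed: "K * g * K \<in> carrier (Sp n)" if g: "g \<in> carrier (Sp n)" for g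
  proof -
    have gc: "g \<in> carrier_mat m m" and ge: "transpose_mat g * ?J * g = ?J"
      using g by (auto simp: carrier_Sp m_def)
    have "transpose_mat (K * g * K) * ?J * (K * g * K)
        = K * (transpose_mat g * (K * ?J * K) * g) * K"
      using K gc J by (simp add: transpose_mult[of _ m m _ m] KT as)
    also have "\<dots> = c \<cdot>\<^sub>m (K * (transpose_mat g * ?J * g) * K)"
      unfolding KJ using K gc J
      by (simp add: mult_smult_distrib[of _ m m _ m] mult_smult_assoc_mat[of _ m m _ m])
    also have "\<dots> = ?J" unfolding ge KJ by (rule eq_matI) (auto simp: c simp flip: mult.assoc)
    finally show ?thesis using K gc by (simp add: carrier_Sp m_def)
  qed
  have invol: "K * (K * g * K) * K = g" if g: "g \<in> carrier (Sp n)" for g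
    using mc[OF g] K by (simp add: as KKx KK)
  have "Ad (GL m) K \<in> hom (Sp n) (Sp n)"
  proof (rule homI)
    fix x y assume x: "x \<in> carrier (Sp n)" and y: "y \<in> carrier (Sp n)"
    show "Ad (GL m) K x \<in> carrier (Sp n)" using closed[OF x] by (simp add: Ad[OF x])
    have xy: "x * y \<in> carrier (Sp n)"
      using monoid.m_closed[OF group.is_monoid[OF group_Sp] x y] by simp
    show "Ad (GL m) K (x \<otimes>\<^bsub>Sp n\<^esub> y) = Ad (GL m) K x \<otimes>\<^bsub>Sp n\<^esub> Ad (GL m) K y"
      using mc[OF x] mc[OF y] K by (simp add: Ad x y xy as KKx)
  qed
  moreover have "bij_betw (Ad (GL m) K) (carrier (Sp n)) (carrier (Sp n))"
    by (rule bij_betw_byWitness[where f' = "Ad (GL m) K"]) (auto simp: Ad closed invol)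
  ultimately have "Ad (GL m) K \<in> iso (Sp n) (Sp n)" by (simp add: iso_def)
  moreover have "Ad (GL m) K (Ad (GL m) K g) = g" if "g \<in> carrier (Sp n)" for g
    using that by (simp add: Ad closed invol)
  moreover have "K * g = g * K \<longleftrightarrow> Ad (GL m) K g = g" if g: "g \<in> carrier (Sp n)" for g
  proof
    assume "K * g = g * K"
    then show "Ad (GL m) K g = g" using mc[OF g] K by (simp add: Ad[OF g] as KK)
  next
    assume "Ad (GL m) K g = g"
    then have "K * g * K = g" by (simp add: Ad[OF g])
    then have "g * K = K * g * K * K" by simp
    also have "\<dots> = K * g" using mc[OF g] K by (simp add: as KK)
    finally show "K * g = g * K" by simp
  qed
  ultimately show ?thesis
    by (auto simp: symmetric_pair_def group_Sp)
qed

lemma diag2_eq: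
  "A \<in> carrier_mat a b \<Longrightarrow> D \<in> carrier_mat c d \<Longrightarrow>
     diag2 A D = four_block_mat A (0\<^sub>m a d) (0\<^sub>m c b) D"
  by (auto simp: diag2_def)

lemma diag2_carrier:
  "A \<in> carrier_mat a b \<Longrightarrow> D \<in> carrier_mat c d \<Longrightarrow> diag2 A D \<in> carrier_mat (a + c) (b + d)"
  by (simp add: diag2_def)

lemma diag2_mult:
  assumes "A \<in> carrier_mat a a" "D \<in> carrier_mat b b" "A' \<in> carrier_mat a a" "D' \<in> carrier_mat b b"
  shows "diag2 A D * diag2 A' D' = diag2 (A * A') (D * D')"
  using assms
  by (simp add: diag2_eq[of _ a a _ b b] mult_four_block_mat[of _ a a _ b _ b _ _ a _ b])

lemma diag2_add:
  assumes "A \<in> carrier_mat a a" "D \<in> carrier_mat b b" "A' \<in> carrier_mat a a" "D' \<in> carrier_mat b b"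
  shows "diag2 A D + diag2 A' D' = diag2 (A + A') (D + D')"
  using assms
  by (simp add: diag2_eq[of _ a a _ b b] add_four_block_mat[of _ a a _ b _ b])

lemma diag2_uminus: "- diag2 A D = diag2 (- A) (- D)"
  unfolding diag2_def by (rule eq_matI) auto

lemma diag2_transpose: "transpose_mat (diag2 A D) = diag2 (transpose_mat A) (transpose_mat D)"
  unfolding diag2_def by (rule eq_matI) auto

lemma diag2_one: "diag2 (1\<^sub>m a) (1\<^sub>m b) = 1\<^sub>m (a + b)"
  by (simp add: diag2_def)

lemma diag2_zero: "diag2 (0\<^sub>m a a) (0\<^sub>m b b) = 0\<^sub>m (a + b) (a + b)"
  by (simp add: diag2_def)

lemma diag2_inj:
  assumes "A \<in> carrier_mat a a" "D \<in> carrier_mat b b" "A' \<in> carrier_mat a a" "D' \<in> carrier_mat b b"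
  shows "diag2 A D = diag2 A' D' \<longleftrightarrow> A = A' \<and> D = D'"
  using assms by (simp add: diag2_eq[of _ a a _ b b] four_block_mat_eq_iff[of _ a a _ b _ b])

lemma Ipq_carrier [simp]: "Ipq p q \<in> carrier_mat (p + q) (p + q)"
  by (simp add: Ipq_def diag2_carrier)

lemma Ipq_sq: "Ipq p q * Ipq p q = 1\<^sub>m (p + q)"
  by (simp add: Ipq_def diag2_mult[of _ p _ q] diag2_one)

lemma Ipq_transpose: "transpose_mat (Ipq p q) = Ipq p q"
proof -
  have "transpose_mat (- 1\<^sub>m q) = (- 1\<^sub>m q :: complex mat)" by (rule eq_matI) auto
  then show ?thesis by (simp add: Ipq_def diag2_transpose)
qed

lemma uminus_eq_self:
  assumes "- A = (A :: complex mat)" "A \<in> carrier_mat n m" shows "A = 0\<^sub>m n m"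
proof (rule eq_matI)
  fix i j assume ij: "i < dim_row (0\<^sub>m n m :: complex mat)" "j < dim_col (0\<^sub>m n m :: complex mat)"
  have "(- A) $$ (i, j) = A $$ (i, j)" using assms by simp
  then have "- (A $$ (i, j)) = A $$ (i, j)" using ij assms(2) by simp
  then have "A $$ (i, j) = 0" by (simp add: complex_eq_iff)
  then show "A $$ (i, j) = 0\<^sub>m n m $$ (i, j)" using ij by simp
qed (use assms in auto)

lemma Ipq_commute:
  assumes A: "A \<in> carrier_mat p p" and B: "B \<in> carrier_mat p q" and C: "C \<in> carrier_mat q p"
    and D: "D \<in> carrier_mat q q"
  shows "Ipq p q * four_block_mat A B C D = four_block_mat A B C D * Ipq p q \<longleftrightarrow>
    B = 0\<^sub>m p q \<and> C = 0\<^sub>m q p"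
proof -
  have "Ipq p q * four_block_mat A B C D = four_block_mat A B (- C) (- D)"
    using assms by (simp add: Ipq_def diag2_eq[of _ p p _ q q] mult_four_block_mat[of _ p p _ q _ q _ _ p _ q])
  moreover have "four_block_mat A B C D * Ipq p q = four_block_mat A (- B) C (- D)"
    using assms by (simp add: Ipq_def diag2_eq[of _ p p _ q q] mult_four_block_mat[of _ p p _ q _ q _ _ p _ q])
  moreover have "four_block_mat A B (- C) (- D) = four_block_mat A (- B) C (- D) \<longleftrightarrow>
      B = - B \<and> - C = C"
    using assms by (subst four_block_mat_eq_iff[of _ p p _ q _ q]) auto
  ultimately show ?thesis
    using uminus_eq_self[OF _ B] uminus_eq_self[OF _ C] by (metis uminus_zero_mat')
qed

lemma Ipq_commuteE:
  assumes "M \<in> carrier_mat (p + q) (p + q)" "Ipq p q * M = M * Ipq p q"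
  obtains A D where "A \<in> carrier_mat p p" "D \<in> carrier_mat q q" "M = diag2 A D"
proof -
  from assms(1) obtain A B C D where c: "A \<in> carrier_mat p p" "B \<in> carrier_mat p q"
      "C \<in> carrier_mat q p" "D \<in> carrier_mat q q" and M: "M = four_block_mat A B C D"
    by (rule four_blocksE)
  with Ipq_commute[OF c] assms(2) have "M = diag2 A D"
    by (simp add: diag2_eq[of _ p p _ q q])
  with c that show thesis by blast
qed

lemma carrier_Sp_blocks:
  assumes c: "A \<in> carrier_mat n n" "B \<in> carrier_mat n n" "C \<in> carrier_mat n n" "D \<in> carrier_mat n n"
  shows "four_block_mat A B C D \<in> carrier (Sp n) \<longleftrightarrow>
     transpose_mat C * A + - (transpose_mat A * C) = 0\<^sub>m n n \<and>
     transpose_mat C * B + - (transpose_mat A * D) = - 1\<^sub>m n \<and>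
     transpose_mat D * A + - (transpose_mat B * C) = 1\<^sub>m n \<and>
     transpose_mat D * B + - (transpose_mat B * D) = 0\<^sub>m n n"
proof -
  have "transpose_mat (four_block_mat A B C D) * Jform n * four_block_mat A B C D
     = four_block_mat (transpose_mat C * A + - (transpose_mat A * C))
         (transpose_mat C * B + - (transpose_mat A * D))
         (transpose_mat D * A + - (transpose_mat B * C))
         (transpose_mat D * B + - (transpose_mat B * D))"
    using c unfolding Jform_def
    by (simp add: transpose_four_block_mat[of _ n n _ n _ n] mult_four_block_mat[of _ n n _ n _ n _ _ n _ n])
  then show ?thesis
    using c by (simp add: carrier_Sp mult_2 Jform_def four_block_mat_eq_iff[of _ n n _ n _ n])
qed

lemma SpSp_blocks_iff:
  assumes c: "A \<in> carrier_mat r r" "B \<in> carrier_mat r r" "C \<in> carrier_mat r r" "D \<in> carrier_mat r r"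
    "A' \<in> carrier_mat s s" "B' \<in> carrier_mat s s" "C' \<in> carrier_mat s s" "D' \<in> carrier_mat s s"
  shows "four_block_mat (diag2 A A') (diag2 B B') (diag2 C C') (diag2 D D') \<in> carrier (Sp (r + s))
     \<longleftrightarrow> four_block_mat A B C D \<in> carrier (Sp r) \<and> four_block_mat A' B' C' D' \<in> carrier (Sp s)"
proof -
  have m1: "- 1\<^sub>m (r + s) = diag2 (- 1\<^sub>m r) (- 1\<^sub>m s)"
    by (simp add: diag2_one flip: diag2_uminus)
  show ?thesis
    using c
    by (auto simp: carrier_Sp_blocks diag2_carrier diag2_transpose diag2_mult[of _ r _ s] diag2_uminus
        diag2_add[of _ r _ s] m1 diag2_inj[of _ r _ s]
        simp flip: diag2_one diag2_zero)
qed

lemma diag2_conj: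
  assumes X: "X \<in> carrier_mat n n" and c: "A \<in> carrier_mat n n" "B \<in> carrier_mat n n"
    "C \<in> carrier_mat n n" "D \<in> carrier_mat n n"
  shows "diag2 X X * four_block_mat A B C D * diag2 X X
     = four_block_mat (X * A * X) (X * B * X) (X * C * X) (X * D * X)"
proof -
  have "Y * X \<in> carrier_mat n n" "X * Y \<in> carrier_mat n n" if "Y \<in> carrier_mat n n" for Y
    using X that by auto
  then show ?thesis
    using X c
    by (simp add: diag2_eq[of _ n n _ n n] mult_four_block_mat[of _ n n _ n _ n _ _ n _ n])
qed

lemma diag2_commuteI:
  assumes X: "X \<in> carrier_mat n n" and c: "A \<in> carrier_mat n n" "B \<in> carrier_mat n n"
    "C \<in> carrier_mat n n" "D \<in> carrier_mat n n"
    and "X * A = A * X" "X * B = B * X" "X * C = C * X" "X * D = D * X"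
  shows "diag2 X X * four_block_mat A B C D = four_block_mat A B C D * diag2 X X"
  using assms
  by (simp add: diag2_eq[of _ n n _ n n] mult_four_block_mat[of _ n n _ n _ n _ _ n _ n])

lemma symmetric_pair_SpSp: "symmetric_pair (Sp (r + s)) (SpSp r s) (theta_SpSp r s)"
proof -
  let ?n = "r + s" and ?I = "Ipq r s"
  let ?K = "diag2 ?I ?I"
  have K: "?K \<in> carrier_mat (2 * ?n) (2 * ?n)"
    unfolding mult_2 by (intro diag2_carrier) simp_all
  have KK: "?K * ?K = 1\<^sub>m (2 * ?n)"
    unfolding mult_2 by (simp add: diag2_mult[of _ ?n _ ?n] Ipq_sq diag2_one)
  have KT: "transpose_mat ?K = ?K" by (simp add: diag2_transpose Ipq_transpose)
  have m: "?K * four_block_mat A B C D * ?K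
      = four_block_mat (?I * A * ?I) (?I * B * ?I) (?I * C * ?I) (?I * D * ?I)"
    if "A \<in> carrier_mat ?n ?n" "B \<in> carrier_mat ?n ?n" "C \<in> carrier_mat ?n ?n" "D \<in> carrier_mat ?n ?n"
    for A B C D
    using that by (rule diag2_conj[OF Ipq_carrier])
  have J: "?K * Jform ?n * ?K = 1 \<cdot>\<^sub>m Jform ?n"
  proof -
    have I: "?I \<in> carrier_mat ?n ?n" by simp
    have "?I * - 1\<^sub>m ?n * ?I = - 1\<^sub>m ?n"
      using uminus_mult_left_mat[of ?I ?I] carrier_matD[OF I]
      by (simp add: mult_uminus_one[OF I] Ipq_sq)
    moreover have "?I * 1\<^sub>m ?n * ?I = 1\<^sub>m ?n" "?I * 0\<^sub>m ?n ?n * ?I = 0\<^sub>m ?n ?n"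
      by (simp_all add: right_mult_one_mat[OF I] right_mult_zero_mat[OF I]
          left_mult_zero_mat[OF I] Ipq_sq)
    moreover have "1 \<cdot>\<^sub>m Jform ?n = Jform ?n" by (rule eq_matI) auto
    ultimately show ?thesis by (simp add: Jform_def m)
  qed
  have "{g \<in> carrier (Sp ?n). ?K * g = g * ?K} = SpSp r s"
  proof (rule equalityI; rule subsetI)
    fix g assume g: "g \<in> {g \<in> carrier (Sp ?n). ?K * g = g * ?K}"
    then have "g \<in> carrier_mat (?n + ?n) (?n + ?n)" using carrier_Sp[of g ?n, unfolded mult_2] by blast
    then obtain P Q R S where c: "P \<in> carrier_mat ?n ?n" "Q \<in> carrier_mat ?n ?n"
      "R \<in> carrier_mat ?n ?n" "S \<in> carrier_mat ?n ?n" and g4: "g = four_block_mat P Q R S"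
      by (rule four_blocksE)
    have "?I * P = P * ?I \<and> ?I * Q = Q * ?I \<and> ?I * R = R * ?I \<and> ?I * S = S * ?I"
      using g c Ipq_carrier[of r s] unfolding g4
      by (simp add: diag2_eq[of _ ?n ?n _ ?n ?n] mult_four_block_mat[of _ ?n ?n _ ?n _ ?n _ _ ?n _ ?n]
          four_block_mat_eq_iff[of _ ?n ?n _ ?n _ ?n])
    then have co: "?I * P = P * ?I" "?I * Q = Q * ?I" "?I * R = R * ?I" "?I * S = S * ?I"
      by blast+
    obtain A A' where A: "A \<in> carrier_mat r r" "A' \<in> carrier_mat s s" "P = diag2 A A'"
      using c(1) co(1) by (rule Ipq_commuteE)
    obtain B B' where B: "B \<in> carrier_mat r r" "B' \<in> carrier_mat s s" "Q = diag2 B B'"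
      using c(2) co(2) by (rule Ipq_commuteE)
    obtain C C' where C: "C \<in> carrier_mat r r" "C' \<in> carrier_mat s s" "R = diag2 C C'"
      using c(3) co(3) by (rule Ipq_commuteE)
    obtain D D' where D: "D \<in> carrier_mat r r" "D' \<in> carrier_mat s s" "S = diag2 D D'"
      using c(4) co(4) by (rule Ipq_commuteE)
    have "g \<in> carrier (Sp ?n)" using g by blast
    then have "four_block_mat A B C D \<in> carrier (Sp r) \<and> four_block_mat A' B' C' D' \<in> carrier (Sp s)"
      unfolding g4 A(3) B(3) C(3) D(3)
      using SpSp_blocks_iff[OF A(1) B(1) C(1) D(1) A(2) B(2) C(2) D(2)] by blast
    then have h: "four_block_mat P Q R S = four_block_mat (diag2 A A') (diag2 B B') (diag2 C C') (diag2 D D')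
       \<and> {A, B, C, D} \<subseteq> carrier_mat r r \<and> {A', B', C', D'} \<subseteq> carrier_mat s s
       \<and> four_block_mat A B C D \<in> carrier (Sp r) \<and> four_block_mat A' B' C' D' \<in> carrier (Sp s)"
      using A B C D by blast
    show "g \<in> SpSp r s"
      unfolding SpSp_def mem_Collect_eq g4 by (intro exI) (rule h)
  next
    fix g assume "g \<in> SpSp r s"
    then obtain A B C D A' B' C' D' where
      h: "g = four_block_mat (diag2 A A') (diag2 B B') (diag2 C C') (diag2 D D')
       \<and> {A, B, C, D} \<subseteq> carrier_mat r r \<and> {A', B', C', D'} \<subseteq> carrier_mat s s
       \<and> four_block_mat A B C D \<in> carrier (Sp r) \<and> four_block_mat A' B' C' D' \<in> carrier (Sp s)"
      unfolding SpSp_def mem_Collect_eq by iprover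
    have d:
      "A \<in> carrier_mat r r" "B \<in> carrier_mat r r" "C \<in> carrier_mat r r" "D \<in> carrier_mat r r"
      "A' \<in> carrier_mat s s" "B' \<in> carrier_mat s s" "C' \<in> carrier_mat s s" "D' \<in> carrier_mat s s"
      and s: "four_block_mat A B C D \<in> carrier (Sp r)" "four_block_mat A' B' C' D' \<in> carrier (Sp s)"
      and g: "g = four_block_mat (diag2 A A') (diag2 B B') (diag2 C C') (diag2 D D')"
      using h by blast+
    have co: "?I * diag2 X Y = diag2 X Y * ?I"
      if "X \<in> carrier_mat r r" "Y \<in> carrier_mat s s" for X Y
      using that Ipq_commute[of X r "0\<^sub>m r s" s "0\<^sub>m s r" Y] by (simp add: diag2_eq[of _ r r _ s s])
    have "?K * g = g * ?K"
      unfolding g by (rule diag2_commuteI[of _ "r + s"]) (use d in \<open>auto intro: co diag2_carrier\<close>)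
    with s SpSp_blocks_iff[OF d] g show "g \<in> {g \<in> carrier (Sp ?n). ?K * g = g * ?K}" by simp
  qed
  with symmetric_pair_conj[OF K KK KT J] show ?thesis
    unfolding theta_SpSp_def by simp
qed

lemma symmetric_pair_GLn: "symmetric_pair (Sp n) (GLn_in_Sp n) (theta_GLn n)"
proof -
  let ?K = "Ipq n n"
  have K: "?K \<in> carrier_mat (2 * n) (2 * n)" and KK: "?K * ?K = 1\<^sub>m (2 * n)"
    by (simp_all add: mult_2 Ipq_sq)
  have J: "?K * Jform n * ?K = - 1 \<cdot>\<^sub>m Jform n"
  proof -
    have "- 1 \<cdot>\<^sub>m Jform n = four_block_mat (0\<^sub>m n n) (1\<^sub>m n) (- 1\<^sub>m n) (0\<^sub>m n n)"
      unfolding Jform_def by (rule eq_matI) auto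
    then show ?thesis
      by (simp add: Jform_def Ipq_def diag2_eq[of _ n n _ n n] mult_four_block_mat[of _ n n _ n _ n _ _ n _ n])
  qed
  have Sp_diag: "diag2 A D \<in> carrier (Sp n) \<longleftrightarrow> transpose_mat D * A = 1\<^sub>m n"
    if A: "A \<in> carrier_mat n n" and D: "D \<in> carrier_mat n n" for A D
  proof -
    have "transpose_mat (transpose_mat D * A) = transpose_mat A * D"
      using that by (simp add: transpose_mult[of _ n n _ n])
    then have "transpose_mat A * D = 1\<^sub>m n" if "transpose_mat D * A = 1\<^sub>m n"
      using that by simp
    then show ?thesis
      using A D by (auto simp: diag2_eq[of _ n n _ n n] carrier_Sp_blocks)
  qed
  have "{g \<in> carrier (Sp n). ?K * g = g * ?K} = GLn_in_Sp n"
  proof (rule equalityI; rule subsetI)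
    fix g assume g: "g \<in> {g \<in> carrier (Sp n). ?K * g = g * ?K}"
    then have "g \<in> carrier_mat (n + n) (n + n)" "?K * g = g * ?K" by (auto simp: carrier_Sp mult_2)
    then obtain A D where AD: "A \<in> carrier_mat n n" "D \<in> carrier_mat n n" "g = diag2 A D"
      by (rule Ipq_commuteE)
    then have e: "transpose_mat D * A = 1\<^sub>m n" using g Sp_diag by auto
    have "A \<in> carrier (GL n)" "inv\<^bsub>GL n\<^esub> A = transpose_mat D"
      using GL_I[OF AD(1) _ e] GL_inv_eq[OF AD(1) _ e] AD by auto
    then show "g \<in> GLn_in_Sp n" unfolding GLn_in_Sp_def AD(3)
      by (metis (mono_tags, lifting) mem_Collect_eq transpose_transpose)
  next
    fix g assume "g \<in> GLn_in_Sp n"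
    then obtain A where A: "A \<in> carrier (GL n)" and g: "g = diag2 A (transpose_mat (inv\<^bsub>GL n\<^esub> A))"
      unfolding GLn_in_Sp_def by blast
    let ?D = "transpose_mat (inv\<^bsub>GL n\<^esub> A)"
    have c: "A \<in> carrier_mat n n" "?D \<in> carrier_mat n n"
      using GL_D[OF A] GL_D[OF group.inv_closed[OF group_GL A]] by auto
    have "transpose_mat ?D * A = 1\<^sub>m n"
      using group.l_inv[OF group_GL A] by simp
    then show "g \<in> {g \<in> carrier (Sp n). ?K * g = g * ?K}"
      using Sp_diag[OF c] Ipq_commute[of A n "0\<^sub>m n n" n "0\<^sub>m n n" ?D] c
      by (simp add: g diag2_eq[OF c])
  qed
  with symmetric_pair_conj[OF K KK Ipq_transpose J] show ?thesis
    unfolding theta_GLn_def by simp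
qed

end

theory Submission
  imports Defs
begin

text \<open>Let \<open>\<theta>\<close> be conjugation by an involutive matrix \<open>K\<close>. If some symplectic \<open>g\<close>
  satisfies \<open>\<theta> g = - g\<close>, then \<open>Ad g\<close> is not in \<open>Ad H\<close>: otherwise \<open>g = h z\<close> with \<open>h \<in> H\<close>
  and \<open>z\<close> central, and since \<open>\<theta>\<close> fixes the center, \<open>\<theta> g = g\<close>. For \<open>GL n\<close> such a \<open>g\<close> is
  the matrix of the form itself, for \<open>r = s\<close> it is a block-diagonal sum of two such matrices.
  Conversely, the center of the symplectic group consists of scalar matrices, so
  \<open>\<theta> g = g z\<close> gives \<open>K g = c g K\<close> for a scalar \<open>c\<close>; taking the trace of
  \<open>K = c g K g\<^sup>-\<^sup>1\<close> yields \<open>c = 1\<close> as soon as the trace \<open>2 (r - s)\<close> of \<open>K\<close> is nonzero.\<close>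

section \<open>Pleasantness criteria in an abstract group\<close>

lemma mem_A_theta:
  "g \<in> A_theta G \<theta> \<longleftrightarrow> g \<in> carrier G \<and> (\<exists>z \<in> grp_center G. \<theta> g = g \<otimes>\<^bsub>G\<^esub> z)"
  by (auto simp: A_theta_def l_coset_def)

text \<open>Multiplying g x g^-1 = h x h^-1 by h^-1 on the left and by g on the right moves h^-1 g
  past x.\<close>

lemma (in group) Ad_eq_imp_center:
  assumes g: "g \<in> carrier G" and h: "h \<in> carrier G" and eq: "Ad G g = Ad G h"
  shows "inv h \<otimes> g \<in> grp_center G"
  unfolding grp_center_def
proof (intro CollectI conjI ballI)
  show "inv h \<otimes> g \<in> carrier G" using g h by simp
  fix x assume x: "x \<in> carrier G"
  have "g \<otimes> x \<otimes> inv g = h \<otimes> x \<otimes> inv h"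
    using fun_cong[OF eq, of x] x by (simp add: Ad_def)
  then have "inv h \<otimes> (g \<otimes> x \<otimes> inv g) \<otimes> g = inv h \<otimes> (h \<otimes> x \<otimes> inv h) \<otimes> g" by simp
  then show "inv h \<otimes> g \<otimes> x = x \<otimes> (inv h \<otimes> g)"
    using g h x by (simp add: m_assoc inv_solve_left l_inv r_inv) (metis inv_closed l_one l_inv m_assoc m_closed)
qed

text \<open>The sign in \<theta> g = - g is abstracted to a nontrivial central \<open>w\<close>. If
  Ad g = Ad h with h fixed by \<theta>, then g = h z with z central, so \<theta> fixes g as well and
  g w = g forces w = 1.\<close>

lemma not_pleasantI:
  assumes sp: "symmetric_pair G H \<theta>" and g: "g \<in> carrier G"
    and w: "w \<in> grp_center G" "w \<noteq> \<one>\<^bsub>G\<^esub>" and \<theta>g: "\<theta> g = g \<otimes>\<^bsub>G\<^esub> w"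
    and fix_center: "\<And>z. z \<in> grp_center G \<Longrightarrow> \<theta> z = z"
  shows "\<not> pleasant G H \<theta>"
proof
  assume "pleasant G H \<theta>"
  interpret G: group G using sp by (simp add: symmetric_pair_def)
  have hom: "\<theta> \<in> hom G G" and H: "H = {g \<in> carrier G. \<theta> g = g}"
    using sp by (auto simp: symmetric_pair_def iso_def)
  have wc: "w \<in> carrier G" using w by (simp add: grp_center_def)
  have "g \<in> A_theta G \<theta>" using g w \<theta>g by (auto simp: mem_A_theta)
  with \<open>pleasant G H \<theta>\<close> obtain h where h: "h \<in> H" "Ad G g = Ad G h"
    unfolding pleasant_def by blast
  have hc: "h \<in> carrier G" "\<theta> h = h" using h H by auto
  define z where "z = inv\<^bsub>G\<^esub> h \<otimes>\<^bsub>G\<^esub> g"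
  have z: "z \<in> grp_center G" unfolding z_def by (rule G.Ad_eq_imp_center[OF g hc(1) h(2)])
  then have zc: "z \<in> carrier G" by (simp add: grp_center_def)
  have gz: "g = h \<otimes>\<^bsub>G\<^esub> z" using g hc by (simp add: z_def flip: G.m_assoc)
  have "g \<otimes>\<^bsub>G\<^esub> w = g"
    using hom_mult[OF hom hc(1) zc] fix_center[OF z] \<theta>g gz hc(2) by simp
  then show False using g wc w(2) by simp
qed

text \<open>Under the second assumption \<open>A_theta G \<theta>\<close> already lies in H, before
  \<open>Ad\<close> is applied.\<close>

lemma pleasantI:
  assumes "symmetric_pair G H \<theta>"
    and "\<And>g z. \<lbrakk>g \<in> carrier G; z \<in> grp_center G; \<theta> g = g \<otimes>\<^bsub>G\<^esub> z\<rbrakk> \<Longrightarrow> \<theta> g = g"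
  shows "pleasant G H \<theta>"
  using assms by (auto simp: pleasant_def symmetric_pair_def mem_A_theta intro!: imageI)

section \<open>Symplectic pairs with an element sent to its negative\<close>

lemma GL_mat_Ad_involution:
  assumes "K \<in> carrier_mat m m" "K * K = 1\<^sub>m m" "g \<in> carrier (GL m)"
  shows "Ad (GL m) K g = K * g * K"
  using assms GL_inv_eq[OF assms(1,1,2)] by (simp add: Ad_def)

lemma Sp_in_GL: "g \<in> carrier (Sp n) \<Longrightarrow> g \<in> carrier (GL (2 * n))"
  by (simp add: Sp_def)

lemma Sp_carrier_mat: "g \<in> carrier (Sp n) \<Longrightarrow> g \<in> carrier_mat (2 * n) (2 * n)"
  by (simp add: carrier_Sp)

lemma uminus_one_in_center_Sp: "- 1\<^sub>m (2 * n) \<in> grp_center (Sp n)"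
proof -
  have J: "Jform n \<in> carrier_mat (2 * n) (2 * n)" by (rule Jform_carrier)
  have "transpose_mat (- 1\<^sub>m (2 * n)) = (- 1\<^sub>m (2 * n) :: complex mat)"
    by (rule eq_matI) auto
  then have "- 1\<^sub>m (2 * n) \<in> carrier (Sp n)"
    using J by (simp add: carrier_Sp)
  moreover have "- 1\<^sub>m (2 * n) * g = g * - 1\<^sub>m (2 * n)" if "g \<in> carrier (Sp n)" for g
    using Sp_carrier_mat[OF that] by simp
  ultimately show ?thesis by (simp add: grp_center_def)
qed

lemma smult_smult_mult_mat: "a \<cdot>\<^sub>m (b \<cdot>\<^sub>m A) = (a * b) \<cdot>\<^sub>m (A :: complex mat)"
  by (rule eq_matI) auto

lemma one_smult_mat: "1 \<cdot>\<^sub>m A = (A :: complex mat)"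
  by (rule eq_matI) auto

lemma smult_transpose_mat: "transpose_mat (a \<cdot>\<^sub>m A) = a \<cdot>\<^sub>m transpose_mat A"
  by (rule eq_matI) auto

lemma uminus_one_neq_one:
  assumes "0 < m" shows "- 1\<^sub>m m \<noteq> (1\<^sub>m m :: complex mat)"
proof
  assume "- 1\<^sub>m m = (1\<^sub>m m :: complex mat)"
  then have "(- 1\<^sub>m m) $$ (0, 0) = (1\<^sub>m m :: complex mat) $$ (0, 0)" by simp
  then show False using assms by simp
qed

text \<open>The conjugating matrix \<open>K\<close> itself need not be symplectic, but a multiple of it suffices
  to see that \<open>K\<close> commutes with the center.\<close>

lemma not_pleasant_Sp:
  assumes n: "0 < n" and sp: "symmetric_pair (Sp n) H (Ad (GL (2 * n)) K)"
    and K: "K \<in> carrier_mat (2 * n) (2 * n)" "K * K = 1\<^sub>m (2 * n)"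
    and c: "c \<cdot>\<^sub>m K \<in> carrier (Sp n)"
    and g: "g \<in> carrier (Sp n)" and anti: "K * g * K = - g"
  shows "\<not> pleasant (Sp n) H (Ad (GL (2 * n)) K)"
proof (rule not_pleasantI[OF sp g uminus_one_in_center_Sp])
  show "- 1\<^sub>m (2 * n) \<noteq> \<one>\<^bsub>Sp n\<^esub>" using uminus_one_neq_one[of "2 * n"] n by simp
  show "Ad (GL (2 * n)) K g = g \<otimes>\<^bsub>Sp n\<^esub> - 1\<^sub>m (2 * n)"
    using Sp_carrier_mat[OF g] by (simp add: GL_mat_Ad_involution[OF K Sp_in_GL[OF g]] anti)
  \<comment> \<open>The zero matrix is not symplectic: it would force \<open>Jform n\<close> to
    vanish, although - J J = 1 and n > 0.\<close>
  have c0: "c \<noteq> 0"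
  proof
    assume "c = 0"
    then have "c \<cdot>\<^sub>m K = 0\<^sub>m (2 * n) (2 * n)" using K(1) by (intro eq_matI) auto
    then have "0\<^sub>m (2 * n) (2 * n) = Jform n"
      using c Jform_carrier[of n] by (simp add: carrier_Sp)
    then have "1\<^sub>m (2 * n) = (0\<^sub>m (2 * n) (2 * n) :: complex mat)"
      using Jform_sq[of n] Jform_carrier[of n]
      by (metis right_mult_zero_mat uminus_carrier_mat)
    then have "(1\<^sub>m (2 * n) :: complex mat) $$ (0, 0) = 0\<^sub>m (2 * n) (2 * n) $$ (0, 0)" by simp
    then show False using n by simp
  qed
  fix z assume z: "z \<in> grp_center (Sp n)"
  then have zS: "z \<in> carrier (Sp n)" by (simp add: grp_center_def)
  note zc = Sp_carrier_mat[OF zS]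
  have "c \<cdot>\<^sub>m (z * K) = z * (c \<cdot>\<^sub>m K)" by (simp only: mult_smult_distrib[OF zc K(1)])
  also have "\<dots> = (c \<cdot>\<^sub>m K) * z" using z c by (simp add: grp_center_def)
  also have "\<dots> = c \<cdot>\<^sub>m (K * z)" by (simp only: mult_smult_assoc_mat[OF K(1) zc])
  finally have "(1 / c) \<cdot>\<^sub>m (c \<cdot>\<^sub>m (z * K)) = (1 / c) \<cdot>\<^sub>m (c \<cdot>\<^sub>m (K * z))" by simp
  then have "z * K = K * z" using c0 by (simp add: smult_smult_mult_mat one_smult_mat)
  then have "K * z * K = z * (K * K)"
    using zc K by (metis assoc_mult_mat)
  then show "Ad (GL (2 * n)) K z = z"
    using zc by (simp add: GL_mat_Ad_involution[OF K Sp_in_GL[OF zS]] K)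
qed

lemma uminus_Jform: "- Jform n = transpose_mat (Jform n)"
  unfolding Jform_def by (rule eq_matI) auto

text \<open>Conjugation by \<open>Ipq n n\<close> negates exactly the off-diagonal blocks, and
  \<open>Jform n\<close> has no others. This makes \<open>Jform n\<close> an element sent to its
  negative, and it also gives the sign by which \<open>Ipq n n\<close> fails to preserve the
  form.\<close>

lemma Ipq_Jform: "Ipq n n * Jform n * Ipq n n = - Jform n"
proof -
  have "- Jform n = four_block_mat (0\<^sub>m n n) (1\<^sub>m n) (- 1\<^sub>m n) (0\<^sub>m n n)"
    unfolding Jform_def by (rule eq_matI) auto
  then show ?thesis
    by (simp add: Jform_def Ipq_def diag2_eq[of _ n n _ n n] mult_four_block_mat[of _ n n _ n _ n _ _ n _ n])
qed

lemma Jform_in_Sp: "Jform n \<in> carrier (Sp n)"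
  using Jform_carrier[of n] by (simp add: carrier_Sp Jform_sq flip: uminus_Jform)

lemma not_pleasant_GLn:
  assumes "1 \<le> n" shows "\<not> pleasant (Sp n) (GLn_in_Sp n) (theta_GLn n)"
proof -
  have I: "Ipq n n \<in> carrier_mat (n + n) (n + n)" by simp
  have J: "Jform n \<in> carrier_mat (n + n) (n + n)" using Jform_carrier[of n] by (simp add: mult_2)
  note IJ = mult_carrier_mat[OF I J]
  \<comment> \<open>\<open>Ipq n n\<close> turns the form into its negative; the factor
    \<open>\<i>\<close>, which enters squared, repairs the sign and makes the multiple
    symplectic.\<close>
  have tr: "transpose_mat (\<i> \<cdot>\<^sub>m Ipq n n) = \<i> \<cdot>\<^sub>m Ipq n n"
    by (metis Ipq_transpose smult_transpose_mat)
  have "\<i> \<cdot>\<^sub>m Ipq n n * Jform n * (\<i> \<cdot>\<^sub>m Ipq n n) = (\<i> * \<i>) \<cdot>\<^sub>m (Ipq n n * Jform n * Ipq n n)"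
    by (simp only: mult_smult_assoc_mat[OF I J] mult_smult_assoc_mat[OF IJ smult_carrier_mat[OF I]]
        mult_smult_distrib[OF IJ I] smult_smult_mult_mat)
  also have "\<dots> = Jform n" unfolding Ipq_Jform by (rule eq_matI) auto
  finally have c: "\<i> \<cdot>\<^sub>m Ipq n n \<in> carrier (Sp n)"
    using Ipq_carrier[of n n] by (simp add: carrier_Sp tr mult_2)
  show ?thesis
    unfolding theta_GLn_def
    by (rule not_pleasant_Sp[OF _ symmetric_pair_GLn[unfolded theta_GLn_def] _ _ c Jform_in_Sp Ipq_Jform])
      (use assms in \<open>simp_all add: mult_2 Ipq_sq\<close>)
qed

lemma diag2_in_Sp:
  assumes "A \<in> carrier_mat n n" "D \<in> carrier_mat n n" "transpose_mat D * A = 1\<^sub>m n"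
  shows "diag2 A D \<in> carrier (Sp n)"
proof -
  have "transpose_mat (transpose_mat D * A) = transpose_mat A * D"
    using assms(1,2) by (simp add: transpose_mult[of _ n n _ n])
  then have "transpose_mat A * D = 1\<^sub>m n" by (simp add: assms(3))
  then show ?thesis
    using assms by (simp add: diag2_eq[of _ n n _ n n] carrier_Sp_blocks)
qed

lemma not_pleasant_SpSp:
  assumes "1 \<le> r" shows "\<not> pleasant (Sp (r + r)) (SpSp r r) (theta_SpSp r r)"
proof -
  let ?n = "r + r" and ?I = "Ipq r r" and ?J = "Jform r"
  \<comment> \<open>\<open>Jform r\<close> has the same size as \<open>Ipq r r\<close>, which
    conjugates it to its negative. Since its transpose is its inverse, placing it twice on the
    diagonal gives a symplectic matrix.\<close>
  let ?K = "diag2 ?I ?I" and ?g = "diag2 ?J ?J"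
  have I: "?I \<in> carrier_mat ?n ?n" by simp
  have J: "?J \<in> carrier_mat ?n ?n" using Jform_carrier[of r] by (simp add: mult_2)
  note IJ = mult_carrier_mat[OF I J]
  have g: "?g \<in> carrier (Sp ?n)"
    using J by (intro diag2_in_Sp) (simp_all add: Jform_sq mult_2 flip: uminus_Jform)
  have "?K \<in> carrier (Sp ?n)" by (intro diag2_in_Sp) (simp_all add: Ipq_transpose Ipq_sq)
  \<comment> \<open>Here the conjugating matrix is itself symplectic, so the multiple 1 is
    enough.\<close>
  then have c: "1 \<cdot>\<^sub>m ?K \<in> carrier (Sp ?n)" by (simp only: one_smult_mat)
  have anti: "?K * ?g * ?K = - ?g"
    by (simp only: diag2_mult[OF I I J J] diag2_mult[OF IJ IJ I I] Ipq_Jform diag2_uminus)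
  show ?thesis
    unfolding theta_SpSp_def
    by (rule not_pleasant_Sp[OF _ symmetric_pair_SpSp[unfolded theta_SpSp_def] _ _ c g anti])
      (use assms I in \<open>simp_all add: mult_2 diag2_carrier diag2_mult[of _ ?n _ ?n] Ipq_sq diag2_one\<close>)
qed

section \<open>The center of the symplectic group\<close>

text \<open>Two kinds of symmetric test matrices suffice. The diagonal matrix units kill the
  off-diagonal entries of P; the all-ones matrix then equates a row sum with a column sum, each
  reduced to one diagonal entry.\<close>

lemma scalar_of_commute_symmetric:
  fixes P :: "complex mat"
  assumes P: "P \<in> carrier_mat n n"
    and com: "\<And>S. S \<in> carrier_mat n n \<Longrightarrow> transpose_mat S = S \<Longrightarrow> P * S = S * P"
  obtains c where "P = c \<cdot>\<^sub>m 1\<^sub>m n"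
proof -
  have off: "P $$ (i, j) = 0" if ij: "i < n" "j < n" "i \<noteq> j" for i j
  proof -
    let ?E = "mat n n (\<lambda>(a, b). if a = j \<and> b = j then 1 else 0) :: complex mat"
    have "P * ?E = ?E * P" by (rule com) auto
    then have "(P * ?E) $$ (i, j) = (?E * P) $$ (i, j)" by simp
    moreover have "(P * ?E) $$ (i, j) = P $$ (i, j)"
      using ij P by (simp add: scalar_prod_def if_distrib sum.delta cong: if_cong)
    moreover have "(?E * P) $$ (i, j) = 0"
      using ij P by (simp add: scalar_prod_def)
    ultimately show ?thesis by simp
  qed
  have diag: "P $$ (i, i) = P $$ (j, j)" if ij: "i < n" "j < n" for i j
  proof -
    let ?E = "mat n n (\<lambda>_. 1) :: complex mat"
    have "P * ?E = ?E * P" by (rule com) auto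
    then have "(P * ?E) $$ (i, j) = (?E * P) $$ (i, j)" by simp
    moreover have "(P * ?E) $$ (i, j) = (\<Sum>k\<in>{0..<n}. P $$ (i, k))"
      using ij P by (simp add: scalar_prod_def)
    moreover have "\<dots> = (\<Sum>k\<in>{0..<n}. if k = i then P $$ (i, i) else 0)"
      using ij by (intro sum.cong) (auto simp: off)
    moreover have "(?E * P) $$ (i, j) = (\<Sum>k\<in>{0..<n}. P $$ (k, j))"
      using ij P by (simp add: scalar_prod_def)
    moreover have "\<dots> = (\<Sum>k\<in>{0..<n}. if k = j then P $$ (j, j) else 0)"
      using ij by (intro sum.cong) (auto simp: off)
    ultimately show ?thesis using ij by (simp add: sum.delta)
  qed
  \<comment> \<open>For n = 0 the entry read is out of range, but then both sides are empty
    matrices.\<close>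
  have "P = P $$ (0, 0) \<cdot>\<^sub>m 1\<^sub>m n"
    by (rule eq_matI) (use P in \<open>auto simp: off intro: diag\<close>)
  then show thesis by (rule that)
qed

lemma add_right_cancel_mat:
  fixes X Y Z :: "complex mat"
  assumes "X \<in> carrier_mat n m" "Y \<in> carrier_mat n m" "Z \<in> carrier_mat n m" "X + Z = Y + Z"
  shows "X = Y"
  by (metis assms add_uminus_minus_mat assoc_add_mat minus_r_inv_mat right_add_zero_mat uminus_carrier_iff_mat)

lemma add_eq_self_mat:
  fixes X Y :: "complex mat"
  assumes "X \<in> carrier_mat n m" "Y \<in> carrier_mat n m" "Y + X = Y"
  shows "X = 0\<^sub>m n m"
  using add_right_cancel_mat[of X n m "0\<^sub>m n m" Y] assms comm_add_mat[of X n m Y] by simp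

text \<open>It is enough to commute with the upper and lower unitriangular block matrices whose
  corner block S is symmetric, the condition that makes them symplectic.\<close>

lemma center_Sp_scalar:
  assumes z: "z \<in> grp_center (Sp n)"
  obtains c where "z = c \<cdot>\<^sub>m 1\<^sub>m (2 * n)"
proof -
  have "z \<in> carrier_mat (n + n) (n + n)"
    using z Sp_carrier_mat[of z n] by (simp add: grp_center_def mult_2)
  then obtain P Q R T where c: "P \<in> carrier_mat n n" "Q \<in> carrier_mat n n"
    "R \<in> carrier_mat n n" "T \<in> carrier_mat n n" and z4: "z = four_block_mat P Q R T"
    by (rule four_blocksE)
  have com: "z * u = u * z" if "u \<in> carrier (Sp n)" for u
    using z that by (simp add: grp_center_def)
  have upper: "S * R = 0\<^sub>m n n \<and> P * S = S * T"
    if S: "S \<in> carrier_mat n n" "transpose_mat S = S" for S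
  proof -
    have "four_block_mat (1\<^sub>m n) S (0\<^sub>m n n) (1\<^sub>m n) \<in> carrier (Sp n)"
      using S uminus_l_inv_mat[OF S(1)] comm_add_mat[of S n n "- S"]
      by (simp add: carrier_Sp_blocks)
    from com[OF this] have
      "P = P + S * R \<and> P * S + Q = Q + S * T"
      using c S unfolding z4
      by (simp add: mult_four_block_mat[of _ n n _ n _ n _ _ n _ n] four_block_mat_eq_iff[of _ n n _ n _ n])
    then show ?thesis
      using add_eq_self_mat[of "S * R" n n P] comm_add_mat[of Q n n "S * T"] c S
        add_right_cancel_mat[of "P * S" n n "S * T" Q] by auto
  qed
  have lower: "Q * S = 0\<^sub>m n n"
    if S: "S \<in> carrier_mat n n" "transpose_mat S = S" for S
  proof -
    have "four_block_mat (1\<^sub>m n) (0\<^sub>m n n) S (1\<^sub>m n) \<in> carrier (Sp n)"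
      using S uminus_l_inv_mat[OF S(1)] comm_add_mat[of S n n "- S"]
      by (simp add: carrier_Sp_blocks)
    from com[OF this] have
      "P + Q * S = P"
      using c S unfolding z4
      by (simp add: mult_four_block_mat[of _ n n _ n _ n _ _ n _ n] four_block_mat_eq_iff[of _ n n _ n _ n])
    then show ?thesis using add_eq_self_mat[of "Q * S" n n P] c S by auto
  qed
  \<comment> \<open>The choice S = 1 removes the off-diagonal blocks and identifies P with T;
    \<open>upper\<close> then says that P commutes with every symmetric matrix.\<close>
  have R: "R = 0\<^sub>m n n" and PT: "P = T" using upper[of "1\<^sub>m n"] c by simp_all
  have Q: "Q = 0\<^sub>m n n" using lower[of "1\<^sub>m n"] c by simp
  obtain a where a: "P = a \<cdot>\<^sub>m 1\<^sub>m n"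
    using scalar_of_commute_symmetric[OF c(1)] upper PT by metis
  have "z = a \<cdot>\<^sub>m 1\<^sub>m (2 * n)"
    unfolding z4 R Q PT[symmetric] a by (rule eq_matI) (auto simp: mult_2)
  then show thesis by (rule that)
qed

section \<open>Traces and the pleasant case\<close>

definition mat_trace :: "'a :: comm_semiring_1 mat \<Rightarrow> 'a" where
  "mat_trace A = (\<Sum>i<dim_row A. A $$ (i, i))"

lemma mat_trace_comm:
  assumes "A \<in> carrier_mat n m" "B \<in> carrier_mat m n"
  shows "mat_trace (A * B) = mat_trace (B * A)"
proof -
  have "mat_trace (A * B) = (\<Sum>i<n. \<Sum>k<m. A $$ (i, k) * B $$ (k, i))"
    using assms by (simp add: mat_trace_def scalar_prod_def atLeast0LessThan)
  also have "\<dots> = (\<Sum>k<m. \<Sum>i<n. B $$ (k, i) * A $$ (i, k))"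
    by (subst sum.swap) (simp add: mult.commute)
  also have "\<dots> = mat_trace (B * A)"
    using assms by (simp add: mat_trace_def scalar_prod_def atLeast0LessThan)
  finally show ?thesis .
qed

lemma mat_trace_smult: "A \<in> carrier_mat n n \<Longrightarrow> mat_trace (c \<cdot>\<^sub>m A) = c * mat_trace A"
  by (simp add: mat_trace_def sum_distrib_left)

lemma mat_trace_diag2:
  assumes "A \<in> carrier_mat p p" "D \<in> carrier_mat q q"
  shows "mat_trace (diag2 A D) = mat_trace A + mat_trace D"
proof -
  have "mat_trace (diag2 A D) = (\<Sum>i<p + q. diag2 A D $$ (i, i))"
    using assms by (simp add: mat_trace_def diag2_def)
  also have "\<dots> = (\<Sum>i<p. diag2 A D $$ (i, i)) + (\<Sum>i<q. diag2 A D $$ (p + i, p + i))"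
    by (induction q) (simp_all add: add.assoc)
  also have "\<dots> = mat_trace A + mat_trace D"
    using assms by (simp add: mat_trace_def diag2_def)
  finally show ?thesis .
qed

lemma mat_trace_Ipq: "mat_trace (Ipq p q) = of_nat p - of_nat q"
proof -
  have "mat_trace (Ipq p q) = mat_trace (1\<^sub>m p) + mat_trace (- 1\<^sub>m q)"
    unfolding Ipq_def by (rule mat_trace_diag2) auto
  then show ?thesis by (simp add: mat_trace_def)
qed

text \<open>The hypothesis reads K = c g K g^-1, and conjugate matrices have equal traces, so the
  nonzero trace of K can be cancelled.\<close>

lemma scalar_one_if_conj_scaled:
  assumes K: "K \<in> carrier_mat m m" "mat_trace K \<noteq> 0" and g: "g \<in> carrier (GL m)"
    and eq: "K * g = c \<cdot>\<^sub>m (g * K)"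
  shows "c = (1 :: complex)"
proof -
  obtain b where b: "b \<in> carrier_mat m m" "g * b = 1\<^sub>m m" "b * g = 1\<^sub>m m"
    using g by (auto simp: carrier_GL)
  have gc: "g \<in> carrier_mat m m" by (rule GL_D[OF g])
  have "K = (K * g) * b" using K gc b by (simp add: assoc_mult_mat[of _ m m _ m _ m])
  also have "\<dots> = c \<cdot>\<^sub>m ((g * K) * b)"
    unfolding eq using K gc b by (simp add: mult_smult_assoc_mat[of _ m m _ m])
  finally have "mat_trace K = c * mat_trace ((g * K) * b)"
    using K gc b by (metis mat_trace_smult mult_carrier_mat)
  also have "mat_trace ((g * K) * b) = mat_trace (b * (g * K))"
    using K gc b by (intro mat_trace_comm) auto
  also have "b * (g * K) = K"
    using K gc b by (simp flip: assoc_mult_mat[of _ m m _ m _ m])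
  finally show ?thesis using K(2) by simp
qed

lemma pleasant_SpSp:
  assumes "r \<noteq> s" shows "pleasant (Sp (r + s)) (SpSp r s) (theta_SpSp r s)"
proof (rule pleasantI[OF symmetric_pair_SpSp])
  let ?n = "r + s" let ?m = "2 * (r + s)" and ?I = "Ipq r s"
  let ?K = "diag2 ?I ?I"
  have K: "?K \<in> carrier_mat ?m ?m" "?K * ?K = 1\<^sub>m ?m"
    unfolding mult_2[of ?n] using Ipq_carrier[of r s]
    by (simp_all only: diag2_carrier diag2_mult[of _ ?n _ ?n] Ipq_sq diag2_one)
  have "mat_trace ?K = 2 * (of_nat r - of_nat s)"
    by (simp add: mat_trace_diag2[of _ ?n _ ?n] mat_trace_Ipq)
  \<comment> \<open>This is the only place where r \<noteq> s enters.\<close>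
  then have tr: "mat_trace ?K \<noteq> 0" using assms by simp
  fix g z
  assume g: "g \<in> carrier (Sp ?n)" and z: "z \<in> grp_center (Sp ?n)"
    and eq: "theta_SpSp r s g = g \<otimes>\<^bsub>Sp ?n\<^esub> z"
  note gG = Sp_in_GL[OF g] and gc = Sp_carrier_mat[OF g]
  obtain c where c: "z = c \<cdot>\<^sub>m 1\<^sub>m ?m" using z by (rule center_Sp_scalar)
  have e: "?K * g * ?K = c \<cdot>\<^sub>m g"
    using eq mult_smult_distrib[OF gc one_carrier_mat, of c] right_mult_one_mat[OF gc]
    unfolding theta_SpSp_def GL_mat_Ad_involution[OF K gG] c Sp_simps by simp
  \<comment> \<open>Inserting K K = 1 turns K g K = c g into K g = c g K, the form needed for the
    trace argument.\<close>
  have "?K * g = ?K * g * (?K * ?K)" using K gc by simp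
  also have "\<dots> = (?K * g * ?K) * ?K"
    using K(1) gc by (intro assoc_mult_mat[symmetric]) auto
  also have "\<dots> = c \<cdot>\<^sub>m (g * ?K)"
    unfolding e using K(1) gc by (simp add: mult_smult_assoc_mat[of _ ?m ?m _ ?m])
  finally have "c = 1" by (rule scalar_one_if_conj_scaled[OF K(1) tr gG])
  then show "theta_SpSp r s g = g"
    by (simp only: theta_SpSp_def GL_mat_Ad_involution[OF K gG] e one_smult_mat)
qed

theorem proposition4p16:
  shows "(\<forall>r s. 1 \<le> r \<and> 1 \<le> s \<longrightarrow>
            (pleasant (Sp (r + s)) (SpSp r s) (theta_SpSp r s) \<longleftrightarrow> r \<noteq> s))
       \<and> (\<forall>n. 1 \<le> n \<longrightarrow> \<not> pleasant (Sp n) (GLn_in_Sp n) (theta_GLn n))"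
  using pleasant_SpSp not_pleasant_SpSp not_pleasant_GLn by blast

end
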